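(* Let $m\ge 1$ and, for each $i=1,\dots,m$, let $\{\mathcal M_i^{[s,t]}: 0\le s\le t\}$ be the family of matrices of structural constants (real square matrices of a fixed size $n_i$) of a chain of evolution algebras. Then the family of block diagonal matrices $\mathcal M^{[s,t]}=\mathcal M_1^{[s,t]}\oplus\mathcal M_2^{[s,t]}\oplus\dots\oplus\mathcal M_m^{[s,t]}$, $0\le s\le t$, generates a chain of evolution algebras, i.e. it is the family of matrices of structural constants of a chain of $(n_1+\dots+n_m)$-dimensional evolution algebras.
   Context: A family $\{E^{[s,t]}: s,t\in\mathbb R,\ 0\le s\le t\}$ of $n$-dimensional evolution algebras over $\mathbb R$ consists of algebras with common basis $e_1,\dots,e_n$ and multiplication $e_ie_i=\sum_{j=1}^n a_{ij}^{[s,t]}e_j$, $e_ie_j=0$ for $i\ne j$; $\mathcal M^{[s,t]}=(a_{ij}^{[s,t]})$ is its matrix of structural constants. The family is a chain of evolution algebras if $\mathcal M^{[s,t]}=\mathcal M^{[s,\tau]}\mathcal M^{[\tau,t]}$ for all $0\le s<\tau<t$. $M_1\oplus\dots\oplus M_m$ denotes the block diagonal matrix with square diagonal blocks $M_1,\dots,M_m$ and zero off-diagonal blocks. *)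

theory Defs
  imports Complex_Main "Jordan_Normal_Form.VS_Connect"
begin

text \<open>The underlying vector space \<open>V\<close> is a carrier-based one, because the dimensions of the
  algebras in a direct sum vary with a natural-number index and so cannot be types.
  The product is only constrained on the carrier; associativity is not assumed.\<close>

locale real_algebra = vectorspace "class_ring :: real ring" V
  for V :: "(real, 'v, 'b) module_scheme" +
  fixes mul :: "'v \<Rightarrow> 'v \<Rightarrow> 'v"
  assumes mul_closed: "\<lbrakk>x \<in> carrier V; y \<in> carrier V\<rbrakk> \<Longrightarrow> mul x y \<in> carrier V"
    and mul_add_left: "\<lbrakk>x \<in> carrier V; y \<in> carrier V; z \<in> carrier V\<rbrakk>
      \<Longrightarrow> mul (x \<oplus>\<^bsub>V\<^esub> y) z = mul x z \<oplus>\<^bsub>V\<^esub> mul y z"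
    and mul_add_right: "\<lbrakk>x \<in> carrier V; y \<in> carrier V; z \<in> carrier V\<rbrakk>
      \<Longrightarrow> mul x (y \<oplus>\<^bsub>V\<^esub> z) = mul x y \<oplus>\<^bsub>V\<^esub> mul x z"
    and mul_smult_left: "\<lbrakk>x \<in> carrier V; y \<in> carrier V\<rbrakk>
      \<Longrightarrow> mul (a \<odot>\<^bsub>V\<^esub> x) y = a \<odot>\<^bsub>V\<^esub> mul x y"
    and mul_smult_right: "\<lbrakk>x \<in> carrier V; y \<in> carrier V\<rbrakk>
      \<Longrightarrow> mul x (a \<odot>\<^bsub>V\<^esub> y) = a \<odot>\<^bsub>V\<^esub> mul x y"

text \<open>Basis vectors and matrix entries are both indexed by \<open>0, \<dots>, n - 1\<close>.
  Since \<open>e\<close> is a basis, \<open>A\<close> is determined by the product.\<close>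

locale evolution_algebra = real_algebra V mul
  for V :: "(real, 'v, 'b) module_scheme" and mul :: "'v \<Rightarrow> 'v \<Rightarrow> 'v" +
  fixes n :: nat and e :: "nat \<Rightarrow> 'v" and A :: "real mat"
  assumes inj_e: "inj_on e {..<n}"
    and basis_e: "basis (e ` {..<n})"
    and structural_matrix: "A \<in> carrier_mat n n"
    and mul_same: "i < n \<Longrightarrow> mul (e i) (e i) = (\<Oplus>\<^bsub>V\<^esub>j\<in>{..<n}. A $$ (i, j) \<odot>\<^bsub>V\<^esub> e j)"
    and mul_distinct: "\<lbrakk>i < n; j < n; i \<noteq> j\<rbrakk> \<Longrightarrow> mul (e i) (e j) = \<zero>\<^bsub>V\<^esub>"

text \<open>\<open>E s t\<close> is the product of the algebra at times \<open>s, t\<close> and \<open>M s t\<close> its matrix of structural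
  constants in the common basis \<open>e\<close>; values outside \<open>0 \<le> s \<le> t\<close> are irrelevant.\<close>

definition chain_of_evolution_algebras ::
  "(real, 'v, 'b) module_scheme \<Rightarrow> nat \<Rightarrow> (nat \<Rightarrow> 'v) \<Rightarrow> (real \<Rightarrow> real \<Rightarrow> 'v \<Rightarrow> 'v \<Rightarrow> 'v)
    \<Rightarrow> (real \<Rightarrow> real \<Rightarrow> real mat) \<Rightarrow> bool" where
  "chain_of_evolution_algebras V n e E M \<longleftrightarrow>
    (\<forall>s t. 0 \<le> s \<and> s \<le> t \<longrightarrow> evolution_algebra V (E s t) n e (M s t)) \<and>
    (\<forall>s \<tau> t. 0 \<le> s \<and> s < \<tau> \<and> \<tau> < t \<longrightarrow> M s t = M s \<tau> * M \<tau> t)"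

end

theory Submission
  imports Defs
begin

text \<open>Every square matrix \<open>A\<close> is the matrix of structural constants of an evolution algebra on
  the coordinate space, with the unit vectors as natural basis. Hence only the identity
  \<open>M s t = M s \<tau> * M \<tau> t\<close> matters, and it holds because block diagonal matrices multiply
  blockwise.\<close>

text \<open>The entrywise product of \<open>x\<close> and \<open>y\<close>, read as a row vector,
  times \<open>A\<close>. For square \<open>A\<close> this is the only bilinear product under which
  distinct unit vectors annihilate each other and the \<open>i\<close>-th unit vector squares to row
  \<open>i\<close> of \<open>A\<close>.\<close>

definition evolution_product :: "real mat \<Rightarrow> real vec \<Rightarrow> real vec \<Rightarrow> real vec" where
  "evolution_product A x y =
    vec (dim_col A) (\<lambda>j. \<Sum>i<dim_row A. x $ i * y $ i * A $$ (i, j))"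

lemma evolution_product_unit_vec:
  assumes A: "A \<in> carrier_mat n n" and i: "i < n" and j: "j < n"
  shows "evolution_product A (unit_vec n i) (unit_vec n j) = (if i = j then row A i else 0\<^sub>v n)"
proof (rule eq_vecI)
  fix k assume "k < dim_vec (if i = j then row A i else 0\<^sub>v n)"
  hence k: "k < n" using A by (auto split: if_splits)
  have "evolution_product A (unit_vec n i) (unit_vec n j) $ k
      = (\<Sum>l<n. unit_vec n i $ l * unit_vec n j $ l * A $$ (l, k))"
    using A k by (simp add: evolution_product_def)
  \<comment> \<open>A summand is nonzero only when \<open>l = i\<close> and \<open>l = j\<close>, so
    at most the term \<open>l = i\<close> survives.\<close>
  also have "\<dots> = (\<Sum>l<n. if l = i then (if i = j then A $$ (i, k) else 0) else 0)"
    by (rule sum.cong) (use i j in auto)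
  also have "\<dots> = (if i = j then row A i else 0\<^sub>v n) $ k"
    using A i k by simp
  finally show "evolution_product A (unit_vec n i) (unit_vec n j) $ k
      = (if i = j then row A i else 0\<^sub>v n) $ k" .
qed (use A in \<open>auto simp: evolution_product_def\<close>)

text \<open>The squares in \<open>evolution_algebra\<close> are given by the abstract sum of the
  module. Comparing coordinates turns that sum into a concrete vector, so that it can be matched
  with a row of the structural matrix.\<close>

lemma finsum_smult_unit_vec:
  fixes v :: "real vec"
  assumes v: "v \<in> carrier_vec n"
  shows "(\<Oplus>\<^bsub>module_vec TYPE(real) n\<^esub>j\<in>{..<n}. v $ j \<cdot>\<^sub>v unit_vec n j) = v"
proof -
  interpret vec_space "TYPE(real)" n .
  let ?f = "\<lambda>j. v $ j \<cdot>\<^sub>v unit_vec n j"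
  have f: "?f \<in> {..<n} \<rightarrow> carrier_vec n" by simp
  show ?thesis
  proof (rule eq_vecI)
    show "dim_vec (finsum V ?f {..<n}) = dim_vec v"
      using finsum_dim[OF _ f] v by simp
    fix k assume "k < dim_vec v"
    hence k: "k < n" using v by simp
    have "finsum V ?f {..<n} $ k = (\<Sum>j<n. ?f j $ k)"
      using index_finsum_vec[OF _ k, of "{..<n}" ?f] f by simp
    also have "\<dots> = (\<Sum>j<n. if j = k then v $ k else 0)"
      by (rule sum.cong) (use k in auto)
    also have "\<dots> = v $ k" using k by simp
    finally show "finsum V ?f {..<n} $ k = v $ k" .
  qed
qed

lemma evolution_algebra_unit_vec:
  assumes A: "A \<in> carrier_mat n n"
  shows "evolution_algebra (module_vec TYPE(real) n) (evolution_product A) n (unit_vec n) A"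
proof -
  interpret vec_space "TYPE(real)" n .
  show ?thesis
  proof unfold_locales
    show "inj_on (unit_vec n :: nat \<Rightarrow> real vec) {..<n}"
      by (auto intro!: inj_onI simp: unit_vec_eq)
    have "unit_vec n ` {..<n} = (set (unit_vecs n) :: real vec set)"
      by (auto simp: unit_vecs_def)
    then show "basis (unit_vec n ` {..<n})"
      using unit_vecs_basis by simp
    show "A \<in> carrier_mat n n" by fact
    fix i assume i: "i < n"
    \<comment> \<open>Expanding row \<open>i\<close> in the unit vectors has the entries of
      \<open>A\<close> as coefficients, which is the shape demanded of the square of the
      \<open>i\<close>-th basis vector.\<close>
    have "row A i = (\<Oplus>\<^bsub>module_vec TYPE(real) n\<^esub>j\<in>{..<n}. row A i $ j \<cdot>\<^sub>v unit_vec n j)"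
      by (rule finsum_smult_unit_vec[symmetric]) (use A i in auto)
    also have "\<dots> = (\<Oplus>\<^bsub>module_vec TYPE(real) n\<^esub>j\<in>{..<n}. A $$ (i, j) \<cdot>\<^sub>v unit_vec n j)"
      by (rule finsum_cong') (use A i in \<open>auto simp: module_vec_simps\<close>)
    finally show "evolution_product A (unit_vec n i) (unit_vec n i)
        = (\<Oplus>\<^bsub>module_vec TYPE(real) n\<^esub>j\<in>{..<n}.
            A $$ (i, j) \<odot>\<^bsub>module_vec TYPE(real) n\<^esub> unit_vec n j)"
      using evolution_product_unit_vec[OF A i i] by (simp add: module_vec_simps)
    fix j assume "j < n" "i \<noteq> j"
    then show "evolution_product A (unit_vec n i) (unit_vec n j) = \<zero>\<^bsub>module_vec TYPE(real) n\<^esub>"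
      using evolution_product_unit_vec[OF A i] by (simp add: module_vec_simps)
  next
    fix x y z :: "real vec" and a :: real
    assume xy: "x \<in> carrier (module_vec TYPE(real) n)" "y \<in> carrier (module_vec TYPE(real) n)"
    show "evolution_product A x y \<in> carrier (module_vec TYPE(real) n)"
      using A by (simp add: module_vec_simps evolution_product_def)
    show "evolution_product A (a \<odot>\<^bsub>module_vec TYPE(real) n\<^esub> x) y
        = a \<odot>\<^bsub>module_vec TYPE(real) n\<^esub> evolution_product A x y"
      using A xy by (intro eq_vecI)
        (auto simp: module_vec_simps evolution_product_def sum_distrib_left ac_simps)
    show "evolution_product A x (a \<odot>\<^bsub>module_vec TYPE(real) n\<^esub> y)
        = a \<odot>\<^bsub>module_vec TYPE(real) n\<^esub> evolution_product A x y"
      using A xy by (intro eq_vecI)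
        (auto simp: module_vec_simps evolution_product_def sum_distrib_left ac_simps)
    assume z: "z \<in> carrier (module_vec TYPE(real) n)"
    show "evolution_product A (x \<oplus>\<^bsub>module_vec TYPE(real) n\<^esub> y) z
        = evolution_product A x z \<oplus>\<^bsub>module_vec TYPE(real) n\<^esub> evolution_product A y z"
      using A xy z by (intro eq_vecI)
        (auto simp: module_vec_simps evolution_product_def distrib_right sum.distrib)
    show "evolution_product A x (y \<oplus>\<^bsub>module_vec TYPE(real) n\<^esub> z)
        = evolution_product A x y \<oplus>\<^bsub>module_vec TYPE(real) n\<^esub> evolution_product A x z"
      using A xy z by (intro eq_vecI)
        (auto simp: module_vec_simps evolution_product_def distrib_left distrib_right sum.distrib)
  qed
qed

text \<open>Induction on the list: splitting off the first block leaves a product of two 2-by-2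
  block matrices with zero off-diagonal blocks. The blocks may be rectangular as long as each pair
  can be multiplied.\<close>

lemma mult_diag_block_mat:
  fixes f g :: "'i \<Rightarrow> 'a :: semiring_0 mat"
  assumes "\<And>i. i \<in> set xs \<Longrightarrow> dim_col (f i) = dim_row (g i)"
  shows "diag_block_mat (map f xs) * diag_block_mat (map g xs)
    = diag_block_mat (map (\<lambda>i. f i * g i) xs)"
  using assms
proof (induction xs)
  case (Cons i ys)
  let ?F = "diag_block_mat (map f ys)" and ?G = "diag_block_mat (map g ys)"
  have IH: "?F * ?G = diag_block_mat (map (\<lambda>i. f i * g i) ys)"
    using Cons by simp
  \<comment> \<open>The inner dimensions agree block by block, hence so do their sums; this makes
    the tails multipliable.\<close>
  have FG: "dim_col ?F = dim_row ?G"
    using Cons.prems by (auto simp: dim_diag_block_mat intro!: arg_cong[where f = sum_list])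
  have fg: "dim_col (f i) = dim_row (g i)"
    using Cons.prems by simp
  have "diag_block_mat (map f (i # ys)) * diag_block_mat (map g (i # ys))
      = four_block_mat (f i * g i) (0\<^sub>m (dim_row (f i)) (dim_col ?G))
          (0\<^sub>m (dim_row ?F) (dim_col (g i))) (?F * ?G)"
  proof -
    have carriers: "f i \<in> carrier_mat (dim_row (f i)) (dim_col (f i))"
      "g i \<in> carrier_mat (dim_col (f i)) (dim_col (g i))"
      "?F \<in> carrier_mat (dim_row ?F) (dim_col ?F)"
      "?G \<in> carrier_mat (dim_col ?F) (dim_col ?G)"
      using fg FG by auto
    note prod = mult_four_block_mat[OF carriers(1) zero_carrier_mat zero_carrier_mat carriers(3)
        carriers(2) zero_carrier_mat zero_carrier_mat carriers(4)]
    show ?thesis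
      \<comment> \<open>Once the inner dimensions are named alike on both sides, the block product
        applies. Each off-diagonal block becomes a sum of two zero products, and each diagonal block
        keeps one product plus a zero matrix.\<close>
      unfolding list.map diag_block_mat.simps Let_def fg[symmetric] FG[symmetric] prod
        left_mult_zero_mat[OF carriers(2)] left_mult_zero_mat[OF carriers(4)]
        right_mult_zero_mat[OF carriers(1)] right_mult_zero_mat[OF carriers(3)]
        left_mult_zero_mat[OF zero_carrier_mat]
        left_add_zero_mat[OF zero_carrier_mat]
        left_add_zero_mat[OF mult_carrier_mat[OF carriers(3,4)]]
        right_add_zero_mat[OF mult_carrier_mat[OF carriers(1,2)]]
      by (rule refl)
  qed
  \<comment> \<open>Reading the tail of the right-hand side as \<open>?F * ?G\<close> shows that its
    zero blocks have the sizes found above.\<close>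
  then show ?case
    by (simp add: Let_def flip: IH)
qed simp

theorem theorem6:
  fixes m :: nat
    and n :: "nat \<Rightarrow> nat"
    and V :: "nat \<Rightarrow> (real, 'v, 'b) module_scheme"
    and e :: "nat \<Rightarrow> nat \<Rightarrow> 'v"
    and E :: "nat \<Rightarrow> real \<Rightarrow> real \<Rightarrow> 'v \<Rightarrow> 'v \<Rightarrow> 'v"
    and M :: "nat \<Rightarrow> real \<Rightarrow> real \<Rightarrow> real mat"
  assumes "m \<ge> 1"
    and "\<And>i. i \<in> {1..m} \<Longrightarrow> chain_of_evolution_algebras (V i) (n i) (e i) (E i) (M i)"
  shows "\<exists>(b :: nat \<Rightarrow> real vec) (F :: real \<Rightarrow> real \<Rightarrow> real vec \<Rightarrow> real vec \<Rightarrow> real vec).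
    chain_of_evolution_algebras (module_vec TYPE(real) (\<Sum>i\<in>{1..m}. n i)) (\<Sum>i\<in>{1..m}. n i) b F
      (\<lambda>s t. diag_block_mat (map (\<lambda>i. M i s t) [1..<Suc m]))"
proof -
  define N where "N = (\<Sum>i\<in>{1..m}. n i)"
  define D where "D s t = diag_block_mat (map (\<lambda>i. M i s t) [1..<Suc m])" for s t
  \<comment> \<open>The restriction to \<open>0 \<le> s\<close> and \<open>s \<le> t\<close> is
    essential: outside this range a chain says nothing about its matrices.\<close>
  have carrier: "M i s t \<in> carrier_mat (n i) (n i)" if "i \<in> {1..m}" "0 \<le> s" "s \<le> t" for i s t
  proof -
    from assms(2)[OF that(1)] that(2,3)
    have "evolution_algebra (V i) (E i s t) (n i) (e i) (M i s t)"
      by (simp add: chain_of_evolution_algebras_def)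
    then show ?thesis by (rule evolution_algebra.structural_matrix)
  qed
  have "D s t \<in> carrier_mat N N" if "0 \<le> s" "s \<le> t" for s t
  proof -
    have "map (\<lambda>i. dim_row (M i s t)) [1..<Suc m] = map n [1..<Suc m]"
      and "map (\<lambda>i. dim_col (M i s t)) [1..<Suc m] = map n [1..<Suc m]"
      using carrier_matD[OF carrier[OF _ that]] by (simp_all del: upt_Suc)
    \<comment> \<open>The list has no repeated entries, so summing along it is summing over the set
      \<open>{1..m}\<close>.\<close>
    moreover have "sum_list (map n [1..<Suc m]) = N"
      by (simp only: N_def sum_list_distinct_conv_sum_set[OF distinct_upt] set_upt
          atLeastLessThanSuc_atLeastAtMost)
    ultimately show ?thesis
      by (intro carrier_matI) (simp_all only: D_def dim_diag_block_mat map_map comp_def)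
  qed
  moreover have "D s t = D s \<tau> * D \<tau> t" if st: "0 \<le> s" "s < \<tau>" "\<tau> < t" for s \<tau> t
  proof -
    have "M i s t = M i s \<tau> * M i \<tau> t" and "dim_col (M i s \<tau>) = dim_row (M i \<tau> t)"
      if "i \<in> {1..m}" for i
      using assms(2)[OF that] carrier[OF that, of s \<tau>] carrier[OF that, of \<tau> t] st
      by (auto simp: chain_of_evolution_algebras_def)
    then show ?thesis
      unfolding D_def by (subst mult_diag_block_mat) (auto intro!: arg_cong[where f = diag_block_mat])
  qed
  \<comment> \<open>The witnesses are the unit vectors, a basis common to all \<open>s\<close> and
    \<open>t\<close>, and at each pair of times the product that \<open>D s t\<close> defines on the
    coordinate space.\<close>
  ultimately have "chain_of_evolution_algebras (module_vec TYPE(real) N) N (unit_vec N)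
      (\<lambda>s t. evolution_product (D s t)) D"
    by (simp add: chain_of_evolution_algebras_def evolution_algebra_unit_vec)
  then show ?thesis
    unfolding N_def D_def by blast
qed

end
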